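(* Let $i<j<k$ be indices in $\{1,\dots,n\}$ and consider the following inequalities in $(x,Y)$: (T7) $(u_j - \ell_j) Y_{ik} + (\ell_k - u_k) Y_{ij} + u_iY_{jk}+ (\ell_ju_k -u_j\ell_k)x_i - u_i\ell_kx_j - u_iu_jx_k + u_iu_j\ell_k \leq 0$; (T8) $u_j Y_{ik} + (\ell_k - u_k) Y_{ij} + (u_i-\ell_i)Y_{jk} -u_j\ell_kx_i + (\ell_iu_k - u_i\ell_k)x_j - u_iu_jx_k + u_iu_j\ell_k \leq 0$; (T9) $(u_j - \ell_j) Y_{ik} + \ell_k Y_{ij} -u_j\ell_kx_i - u_i\ell_kx_j +u_i(\ell_j- u_j)x_k + u_iu_j \ell_k \leq 0$; (T10) $\ell_k Y_{ij} + (u_i - \ell_i) Y_{jk} - u_j\ell_kx_i -u_i\ell_kx_j+(\ell_i- u_i)u_jx_k + u_iu_j \ell_k \leq 0$; (T11) $u_iY_{jk} - u_i\ell_kx_j - u_iu_jx_k + u_iu_j\ell_k \leq 0$; (T12) $u_jY_{ik} - u_j\ell_kx_i - u_iu_jx_k + u_iu_j\ell_k \leq 0$. Then (T7) and (T8) cut feasible solutions of $(P_{S_0,\ldots,S_m})$ (that is, each of them is violated by some feasible solution of $(P_{S_0,\ldots,S_m})$), while (T9), (T10), (T11) and (T12) are redundant for $(P_{S_0,\ldots,S_m})$ (that is, they are satisfied by every feasible solution of it).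
   Context: Problem $(P)$ is: minimize $\langle Q_0,xx^T\rangle+c_0^Tx$ over $x\in\mathbb{R}^n$ subject to $\langle Q_r,xx^T\rangle+c_r^Tx\le b_r$ for $r=1,\dots,m$ and $\ell_p\le x_p\le u_p$ for $p=1,\dots,n$. Here $Q_0,\dots,Q_m$ are symmetric $n\times n$ real matrices, $c_0,\dots,c_m\in\mathbb{R}^n$, $b\in\mathbb{R}^m$, $u\in\mathbb{R}^n$, $\ell\in\mathbb{R}_+^n$, the feasible domain of $(P)$ is assumed non-empty, and $\langle A,B\rangle=\sum_{p,q}a_{pq}b_{pq}$. Let $S_0,\dots,S_m$ be any symmetric positive semidefinite $n\times n$ matrices. The convex relaxation $(P_{S_0,\ldots,S_m})$ of $(P)$ is the problem of minimizing $\langle S_0,xx^T\rangle+c_0^Tx+\langle Q_0-S_0,Y\rangle$ over $(x,Y)\in\mathbb{R}^n\times\mathbb{R}^{n\times n}$ subject to: - $\ell_p\le x_p\le u_p$ for all $p$; - $\langle S_r,xx^T\rangle+c_r^Tx+\langle Q_r-S_r,Y\rangle\le b_r$ for $r=1,\dots,m$; - $Y_{qp}=Y_{pq}$ for all $p<q$; - the McCormick inequalities, for all $1\le p\le q\le n$: $Y_{pq}-u_qx_p-\ell_px_q+u_q\ell_p\le 0$, $Y_{pq}-u_px_q-\ell_qx_p+u_p\ell_q\le 0$, $-Y_{pq}+u_qx_p+u_px_q-u_pu_q\le 0$, $-Y_{pq}+\ell_qx_p+\ell_px_q-\ell_p\ell_q\le 0$.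
   Formalization: That (T7) and (T8) cut feasible solutions is proved when ℓ ≤ u, ℓ < u at i, j, k, and the right-hand sides b_r are sufficiently large (no condition on b if m = 0); without such conditions it fails, e.g. for ℓ = u or when a constraint forces x_i = ℓ_i (for T7) or x_j = ℓ_j (for T8). *)

theory Defs
  imports "HOL-Analysis.Analysis"
begin

text \<open>Abbreviations without a sort: writing \<open>real^'n\<close> would pin the sort of \<open>'n\<close> to \<open>finite\<close>,
  but the index type of the relaxation is also linearly ordered.\<close>

type_synonym 'n rvector = "real^'n"
type_synonym 'n rmatrix = "real^'n^'n"

record 'v min_problem =
  objective :: "'v \<Rightarrow> real"
  feasible :: "'v set"

definition psd :: "'n::finite rmatrix \<Rightarrow> bool" where
  "psd A \<longleftrightarrow> transpose A = A \<and> (\<forall>x. 0 \<le> x \<bullet> (A *v x))"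

definition outer :: "'n::finite rvector \<Rightarrow> 'n rmatrix" where
  "outer x = (\<chi> p q. x $ p * x $ q)"

text \<open>On matrices \<open>A \<bullet> B\<close> is the entrywise inner product \<open>\<Sum>p q. A $ p $ q * B $ p $ q\<close>.
  Index 0 of \<open>Q\<close>, \<open>c\<close>, \<open>S\<close> belongs to the objective, indices \<open>1..m\<close> to the constraints;
  \<open>m = 0\<close> is allowed, and values at other indices are irrelevant.\<close>

definition qcqp ::
  "nat \<Rightarrow> (nat \<Rightarrow> 'n::finite rmatrix) \<Rightarrow> (nat \<Rightarrow> 'n rvector) \<Rightarrow> (nat \<Rightarrow> real) \<Rightarrow> 'n rvector \<Rightarrow> 'n rvector
    \<Rightarrow> 'n rvector min_problem" where
  "qcqp m Q c b l u =
    \<lparr> objective = (\<lambda>x. Q 0 \<bullet> outer x + c 0 \<bullet> x),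
      feasible = {x. (\<forall>r\<in>{1..m}. Q r \<bullet> outer x + c r \<bullet> x \<le> b r) \<and>
                     (\<forall>p. l $ p \<le> x $ p \<and> x $ p \<le> u $ p)} \<rparr>"

definition mccormick ::
  "'n::finite rvector \<Rightarrow> 'n rvector \<Rightarrow> 'n rvector \<Rightarrow> 'n rmatrix \<Rightarrow> 'n \<Rightarrow> 'n \<Rightarrow> bool" where
  "mccormick l u x Y p q \<longleftrightarrow>
     Y$p$q - u$q * x$p - l$p * x$q + u$q * l$p \<le> 0 \<and>
     Y$p$q - u$p * x$q - l$q * x$p + u$p * l$q \<le> 0 \<and>
     - Y$p$q + u$q * x$p + u$p * x$q - u$p * u$q \<le> 0 \<and>
     - Y$p$q + l$q * x$p + l$p * x$q - l$p * l$q \<le> 0"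

definition relaxation ::
  "nat \<Rightarrow> (nat \<Rightarrow> 'n::{finite,linorder} rmatrix) \<Rightarrow> (nat \<Rightarrow> 'n rvector) \<Rightarrow> (nat \<Rightarrow> real)
    \<Rightarrow> 'n rvector \<Rightarrow> 'n rvector \<Rightarrow> (nat \<Rightarrow> 'n rmatrix)
    \<Rightarrow> ('n rvector \<times> 'n rmatrix) min_problem" where
  "relaxation m Q c b l u S =
    \<lparr> objective = (\<lambda>(x, Y). S 0 \<bullet> outer x + c 0 \<bullet> x + (Q 0 - S 0) \<bullet> Y),
      feasible = {(x, Y).
        (\<forall>p. l $ p \<le> x $ p \<and> x $ p \<le> u $ p) \<and>
        (\<forall>r\<in>{1..m}. S r \<bullet> outer x + c r \<bullet> x + (Q r - S r) \<bullet> Y \<le> b r) \<and>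
        (\<forall>p q. p < q \<longrightarrow> Y $ q $ p = Y $ p $ q) \<and>
        (\<forall>p q. p \<le> q \<longrightarrow> mccormick l u x Y p q)} \<rparr>"

text \<open>An inequality in the variables of a problem is given as the predicate of the points
  satisfying it.\<close>

definition cuts :: "('v \<Rightarrow> bool) \<Rightarrow> 'v min_problem \<Rightarrow> bool" where
  "cuts T P \<longleftrightarrow> (\<exists>z\<in>feasible P. \<not> T z)"

definition redundant :: "('v \<Rightarrow> bool) \<Rightarrow> 'v min_problem \<Rightarrow> bool" where
  "redundant T P \<longleftrightarrow> (\<forall>z\<in>feasible P. T z)"

definition T7 :: "'n::finite rvector \<Rightarrow> 'n rvector \<Rightarrow> 'n \<Rightarrow> 'n \<Rightarrow> 'n \<Rightarrow> 'n rvector \<times> 'n rmatrix \<Rightarrow> bool" where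
  "T7 l u i j k = (\<lambda>(x, Y).
     (u$j - l$j) * Y$i$k + (l$k - u$k) * Y$i$j + u$i * Y$j$k
     + (l$j * u$k - u$j * l$k) * x$i - u$i * l$k * x$j - u$i * u$j * x$k
     + u$i * u$j * l$k \<le> 0)"

definition T8 :: "'n::finite rvector \<Rightarrow> 'n rvector \<Rightarrow> 'n \<Rightarrow> 'n \<Rightarrow> 'n \<Rightarrow> 'n rvector \<times> 'n rmatrix \<Rightarrow> bool" where
  "T8 l u i j k = (\<lambda>(x, Y).
     u$j * Y$i$k + (l$k - u$k) * Y$i$j + (u$i - l$i) * Y$j$k
     - u$j * l$k * x$i + (l$i * u$k - u$i * l$k) * x$j - u$i * u$j * x$k
     + u$i * u$j * l$k \<le> 0)"

definition T9 :: "'n::finite rvector \<Rightarrow> 'n rvector \<Rightarrow> 'n \<Rightarrow> 'n \<Rightarrow> 'n \<Rightarrow> 'n rvector \<times> 'n rmatrix \<Rightarrow> bool" where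
  "T9 l u i j k = (\<lambda>(x, Y).
     (u$j - l$j) * Y$i$k + l$k * Y$i$j
     - u$j * l$k * x$i - u$i * l$k * x$j + u$i * (l$j - u$j) * x$k
     + u$i * u$j * l$k \<le> 0)"

definition T10 :: "'n::finite rvector \<Rightarrow> 'n rvector \<Rightarrow> 'n \<Rightarrow> 'n \<Rightarrow> 'n \<Rightarrow> 'n rvector \<times> 'n rmatrix \<Rightarrow> bool" where
  "T10 l u i j k = (\<lambda>(x, Y).
     l$k * Y$i$j + (u$i - l$i) * Y$j$k
     - u$j * l$k * x$i - u$i * l$k * x$j + (l$i - u$i) * u$j * x$k
     + u$i * u$j * l$k \<le> 0)"

definition T11 :: "'n::finite rvector \<Rightarrow> 'n rvector \<Rightarrow> 'n \<Rightarrow> 'n \<Rightarrow> 'n \<Rightarrow> 'n rvector \<times> 'n rmatrix \<Rightarrow> bool" where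
  "T11 l u i j k = (\<lambda>(x, Y).
     u$i * Y$j$k - u$i * l$k * x$j - u$i * u$j * x$k + u$i * u$j * l$k \<le> 0)"

definition T12 :: "'n::finite rvector \<Rightarrow> 'n rvector \<Rightarrow> 'n \<Rightarrow> 'n \<Rightarrow> 'n \<Rightarrow> 'n rvector \<times> 'n rmatrix \<Rightarrow> bool" where
  "T12 l u i j k = (\<lambda>(x, Y).
     u$j * Y$i$k - u$j * l$k * x$i - u$i * u$j * x$k + u$i * u$j * l$k \<le> 0)"

end

theory Submission
  imports Defs
begin

text \<open>
  Write \<open>d\<^sub>p = u\<^sub>p - l\<^sub>p\<close> and rescale the box to the unit cube: \<open>x\<^sub>p = l\<^sub>p + d\<^sub>p t\<^sub>p\<close>, and
  \<open>Y\<^sub>p\<^sub>q = l\<^sub>p l\<^sub>q + l\<^sub>p d\<^sub>q t\<^sub>q + l\<^sub>q d\<^sub>p t\<^sub>p + d\<^sub>p d\<^sub>q W\<^sub>p\<^sub>q\<close>. When all \<open>d\<^sub>p\<close> are positive, the McCormick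
  inequalities say \<open>max 0 (t\<^sub>p + t\<^sub>q - 1) \<le> W\<^sub>p\<^sub>q \<le> min t\<^sub>p t\<^sub>q\<close>, and (T7) is the combination
  \<open>d\<^sub>j d\<^sub>k (l\<^sub>i (W\<^sub>j\<^sub>k - t\<^sub>j) + d\<^sub>i (W\<^sub>i\<^sub>k + W\<^sub>j\<^sub>k - W\<^sub>i\<^sub>j - t\<^sub>k)) \<le> 0\<close>
  of a McCormick inequality and the triangle inequality \<open>W\<^sub>i\<^sub>k + W\<^sub>j\<^sub>k - W\<^sub>i\<^sub>j \<le> t\<^sub>k\<close>. The same
  holds for (T8), which is (T7) with \<open>i\<close> and \<open>j\<close> exchanged.

  McCormick inequalities see only one pair of indices at a time, so they do not imply a triangle
  inequality. At the centre of the box they allow each pair to be perfectly correlated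
  (\<open>W\<^sub>p\<^sub>q = 1/2\<close>) or perfectly anticorrelated (\<open>W\<^sub>p\<^sub>q = 0\<close>). The lifted matrix \<open>twisted\<close> below
  correlates \<open>i\<close> with \<open>k\<close> and \<open>j\<close> with \<open>k\<close>, but anticorrelates \<open>i\<close> with \<open>j\<close>, an inconsistent
  choice that violates both (T7) and (T8) by \<open>d\<^sub>i d\<^sub>j d\<^sub>k / 2\<close>. The right-hand sides \<open>b\<close> only have to
  be large enough for this point to satisfy the quadratic constraints of the relaxation, and for
  the centre itself to be feasible in the original problem.

  On the other hand, each of (T9)--(T12) involves only McCormick upper bounds: its left-hand side
  is a combination of one or two of them with coefficients among \<open>d\<^sub>i\<close>, \<open>d\<^sub>j\<close>, \<open>u\<^sub>i\<close>, \<open>u\<^sub>j\<close>, \<open>l\<^sub>k\<close>,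
  all nonnegative since \<open>0 \<le> l \<le> u\<close>.
\<close>

section \<open>A point of the McCormick relaxation with an inconsistent triangle\<close>

definition centre :: "'n::finite rvector \<Rightarrow> 'n rvector \<Rightarrow> 'n rvector" where
  "centre l u = (\<chi> p. (l$p + u$p) / 2)"

text \<open>Each entry averages the products of two opposite corners of the rectangle
  \<open>[l\<^sub>p, u\<^sub>p] \<times> [l\<^sub>q, u\<^sub>q]\<close>: the corners on the decreasing diagonal for the pair \<open>{i, j}\<close>, and those on
  the increasing diagonal for all other pairs.\<close>

definition twisted :: "'n::finite rvector \<Rightarrow> 'n rvector \<Rightarrow> 'n \<Rightarrow> 'n \<Rightarrow> 'n rmatrix" where
  "twisted l u i j = (\<chi> p q.
     if {p, q} = {i, j} then (l$p * u$q + u$p * l$q) / 2 else (l$p * l$q + u$p * u$q) / 2)"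

lemma twisted_symmetric: "twisted l u i j $ q $ p = twisted l u i j $ p $ q"
  by (simp add: twisted_def insert_commute algebra_simps)

text \<open>The McCormick inequalities are affine in \<open>(x\<^sub>p, x\<^sub>q, Y\<^sub>p\<^sub>q)\<close> and hold at every lifted corner
  of the rectangle, so they hold at the average of two opposite corners, which has the centre as
  its \<open>x\<close>-part. The slacks there are \<open>0\<close> and \<open>d\<^sub>p d\<^sub>q / 2\<close>.\<close>

lemma mccormick_centre_twisted:
  assumes "l$p \<le> u$p" "l$q \<le> u$q"
  shows "mccormick l u (centre l u) (twisted l u i j) p q"
proof -
  have "0 \<le> (u$p - l$p) * (u$q - l$q)"
    using assms by simp
  then show ?thesis
    by (auto simp: mccormick_def centre_def twisted_def field_simps)
qed

lemma T8_iff_T7_swap: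
  assumes "Y$j$i = Y$i$j"
  shows "T8 l u i j k (x, Y) \<longleftrightarrow> T7 l u j i k (x, Y)"
  using assms by (simp add: T7_def T8_def algebra_simps)

lemma twisted_violates_T7:
  assumes "k \<noteq> i" "k \<noteq> j"
    and "l$i < u$i" "l$j < u$j" "l$k < u$k"
  shows "\<not> T7 l u i j k (centre l u, twisted l u i j)"
proof -
  let ?Y = "twisted l u i j"
  have Y: "?Y$i$k = (l$i * l$k + u$i * u$k) / 2" "?Y$j$k = (l$j * l$k + u$j * u$k) / 2"
    "?Y$i$j = (l$i * u$j + u$i * l$j) / 2"
    using assms(1,2) by (auto simp: twisted_def doubleton_eq_iff)
  have "(u$j - l$j) * ?Y$i$k + (l$k - u$k) * ?Y$i$j + u$i * ?Y$j$k
      + (l$j * u$k - u$j * l$k) * centre l u $ i - u$i * l$k * centre l u $ j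
      - u$i * u$j * centre l u $ k + u$i * u$j * l$k
    = (u$i - l$i) * (u$j - l$j) * (u$k - l$k) / 2"
    unfolding Y by (simp add: centre_def field_simps)
  moreover have "0 < (u$i - l$i) * (u$j - l$j) * (u$k - l$k)"
    using assms by simp
  ultimately show ?thesis
    by (simp add: T7_def)
qed

lemma twisted_violates_T8:
  assumes "k \<noteq> i" "k \<noteq> j"
    and "l$i < u$i" "l$j < u$j" "l$k < u$k"
  shows "\<not> T8 l u i j k (centre l u, twisted l u i j)"
proof -
  have "twisted l u i j = twisted l u j i"
    by (simp add: twisted_def insert_commute)
  with twisted_violates_T7[of k j i l u] assms show ?thesis
    by (simp add: T8_iff_T7_swap twisted_symmetric)
qed

lemma centre_in_box:
  assumes "l$p \<le> u$p"
  shows "l$p \<le> centre l u $ p \<and> centre l u $ p \<le> u$p"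
  using assms by (simp add: centre_def)

lemma T7_T8_cut:
  fixes l u :: "'n::{finite,linorder} rvector"
  assumes "i < j" "j < k" and box: "\<And>p. l$p \<le> u$p"
    and strict: "l$i < u$i" "l$j < u$j" "l$k < u$k"
  shows "\<exists>b0. \<forall>b. (\<forall>r\<in>{1..m}. b0 r \<le> b r) \<longrightarrow>
    feasible (qcqp m Q c b l u) \<noteq> {} \<and>
    cuts (T7 l u i j k) (relaxation m Q c b l u S) \<and>
    cuts (T8 l u i j k) (relaxation m Q c b l u S)"
proof -
  let ?x = "centre l u" and ?Y = "twisted l u i j"
  \<comment> \<open>The first term makes the centre feasible for the original problem, the second makes the
    twisted point feasible for the relaxation.\<close>
  define b0 where "b0 r = max (Q r \<bullet> outer ?x + c r \<bullet> ?x)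
    (S r \<bullet> outer ?x + c r \<bullet> ?x + (Q r - S r) \<bullet> ?Y)" for r
  have "feasible (qcqp m Q c b l u) \<noteq> {} \<and>
      cuts (T7 l u i j k) (relaxation m Q c b l u S) \<and>
      cuts (T8 l u i j k) (relaxation m Q c b l u S)"
    if b: "\<forall>r\<in>{1..m}. b0 r \<le> b r" for b
  proof -
    have "?x \<in> feasible (qcqp m Q c b l u)"
      using b box centre_in_box[of l _ u] by (auto simp: qcqp_def b0_def)
    moreover have "(?x, ?Y) \<in> feasible (relaxation m Q c b l u S)"
      using b box centre_in_box[of l _ u]
      by (auto simp: relaxation_def b0_def mccormick_centre_twisted twisted_symmetric)
    moreover have "k \<noteq> i" "k \<noteq> j"
      using assms(1,2) by auto
    moreover from this have "\<not> T7 l u i j k (?x, ?Y)" "\<not> T8 l u i j k (?x, ?Y)"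
      using strict by (simp_all add: twisted_violates_T7 twisted_violates_T8)
    ultimately show ?thesis
      unfolding cuts_def by blast
  qed
  then show ?thesis by blast
qed

section \<open>Combinations of McCormick inequalities\<close>

lemma feasible_qcqp_imp_bounds_le:
  assumes "feasible (qcqp m Q c b l u) \<noteq> {}"
  shows "l$p \<le> u$p"
  using assms by (auto simp: qcqp_def intro: order_trans)

lemma mccormick_upper_bounds:
  assumes "mccormick l u x Y p q"
  shows "Y$p$q - u$q * x$p - l$p * x$q + u$q * l$p \<le> 0"
    and "Y$p$q - u$p * x$q - l$q * x$p + u$p * l$q \<le> 0"
  using assms by (auto simp: mccormick_def)

text \<open>The constant term \<open>u\<^sub>i u\<^sub>j l\<^sub>k\<close> is recovered as \<open>d\<^sub>j u\<^sub>i l\<^sub>k + l\<^sub>k l\<^sub>j u\<^sub>i\<close>, which dictates the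
  weights \<open>d\<^sub>j\<close> and \<open>l\<^sub>k\<close> of the upper bounds on \<open>Y\<^sub>i\<^sub>k\<close> and \<open>Y\<^sub>i\<^sub>j\<close>.\<close>

lemma mccormick_imp_T9:
  assumes ij: "mccormick l u x Y i j" and ik: "mccormick l u x Y i k"
    and "0 \<le> l$k" "l$j \<le> u$j"
  shows "T9 l u i j k (x, Y)"
proof -
  have "(u$j - l$j) * (Y$i$k - u$i * x$k - l$k * x$i + u$i * l$k) \<le> 0"
    using mccormick_upper_bounds(2)[OF ik] assms by (simp add: mult_nonneg_nonpos)
  moreover have "l$k * (Y$i$j - u$i * x$j - l$j * x$i + u$i * l$j) \<le> 0"
    using mccormick_upper_bounds(2)[OF ij] assms by (simp add: mult_nonneg_nonpos)
  ultimately show ?thesis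
    by (simp add: T9_def algebra_simps)
qed

text \<open>This is the case of (T9) with \<open>i\<close> and \<open>j\<close> exchanged, which turns the upper bound on \<open>Y\<^sub>i\<^sub>j\<close>
  into the other one of the two.\<close>

lemma mccormick_imp_T10:
  assumes ij: "mccormick l u x Y i j" and jk: "mccormick l u x Y j k"
    and "0 \<le> l$k" "l$i \<le> u$i"
  shows "T10 l u i j k (x, Y)"
proof -
  have "(u$i - l$i) * (Y$j$k - u$j * x$k - l$k * x$j + u$j * l$k) \<le> 0"
    using mccormick_upper_bounds(2)[OF jk] assms by (simp add: mult_nonneg_nonpos)
  moreover have "l$k * (Y$i$j - u$j * x$i - l$i * x$j + u$j * l$i) \<le> 0"
    using mccormick_upper_bounds(1)[OF ij] assms by (simp add: mult_nonneg_nonpos)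
  ultimately show ?thesis
    by (simp add: T10_def algebra_simps)
qed

lemma mccormick_imp_T11:
  assumes jk: "mccormick l u x Y j k" and "0 \<le> u$i"
  shows "T11 l u i j k (x, Y)"
proof -
  have "u$i * (Y$j$k - u$j * x$k - l$k * x$j + u$j * l$k) \<le> 0"
    using mccormick_upper_bounds(2)[OF jk] assms by (simp add: mult_nonneg_nonpos)
  then show ?thesis
    by (simp add: T11_def algebra_simps)
qed

lemma mccormick_imp_T12:
  assumes ik: "mccormick l u x Y i k" and "0 \<le> u$j"
  shows "T12 l u i j k (x, Y)"
proof -
  have "u$j * (Y$i$k - u$i * x$k - l$k * x$i + u$i * l$k) \<le> 0"
    using mccormick_upper_bounds(2)[OF ik] assms by (simp add: mult_nonneg_nonpos)
  then show ?thesis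
    by (simp add: T12_def algebra_simps)
qed

lemma T9_T10_T11_T12_redundant:
  fixes l u :: "'n::{finite,linorder} rvector"
  assumes "i < j" "j < k" and l_nonneg: "\<And>p. 0 \<le> l$p" and box: "\<And>p. l$p \<le> u$p"
  shows "redundant (T9 l u i j k) (relaxation m Q c b l u S) \<and>
    redundant (T10 l u i j k) (relaxation m Q c b l u S) \<and>
    redundant (T11 l u i j k) (relaxation m Q c b l u S) \<and>
    redundant (T12 l u i j k) (relaxation m Q c b l u S)"
proof -
  have "0 \<le> u$p" for p
    using l_nonneg box order_trans by blast
  moreover have "mccormick l u x Y i j \<and> mccormick l u x Y i k \<and> mccormick l u x Y j k"
    if "(x, Y) \<in> feasible (relaxation m Q c b l u S)" for x Y
    using that assms(1,2) by (auto simp: relaxation_def)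
  ultimately have "T9 l u i j k z \<and> T10 l u i j k z \<and> T11 l u i j k z \<and> T12 l u i j k z"
    if "z \<in> feasible (relaxation m Q c b l u S)" for z
    using that l_nonneg box
    by (cases z) (simp add: mccormick_imp_T9 mccormick_imp_T10 mccormick_imp_T11 mccormick_imp_T12)
  then show ?thesis
    by (simp add: redundant_def)
qed

section \<open>Which inequalities strengthen the relaxation\<close>

theorem proposition2:
  fixes m :: nat
    and Q S :: "nat \<Rightarrow> 'n::{finite,linorder} rmatrix"
    and c :: "nat \<Rightarrow> 'n rvector"
    and l u :: "'n rvector"
    and i j k :: 'n
  assumes Q_sym: "\<And>r. r \<le> m \<Longrightarrow> transpose (Q r) = Q r"
    and S_psd: "\<And>r. r \<le> m \<Longrightarrow> psd (S r)"
    and l_nonneg: "\<And>p. 0 \<le> l $ p"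
    and ij: "i < j" and jk: "j < k"
  shows
    "((\<forall>p. l $ p \<le> u $ p) \<and> l $ i < u $ i \<and> l $ j < u $ j \<and> l $ k < u $ k \<longrightarrow>
       (\<exists>b0. \<forall>b. (\<forall>r\<in>{1..m}. b0 r \<le> b r) \<longrightarrow>
          feasible (qcqp m Q c b l u) \<noteq> {} \<and>
          cuts (T7 l u i j k) (relaxation m Q c b l u S) \<and>
          cuts (T8 l u i j k) (relaxation m Q c b l u S)))
     \<and>
     (\<forall>b. feasible (qcqp m Q c b l u) \<noteq> {} \<longrightarrow>
          redundant (T9 l u i j k) (relaxation m Q c b l u S) \<and>
          redundant (T10 l u i j k) (relaxation m Q c b l u S) \<and>
          redundant (T11 l u i j k) (relaxation m Q c b l u S) \<and>
          redundant (T12 l u i j k) (relaxation m Q c b l u S))"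
proof (intro conjI[OF impI allI[OF impI]])
  assume "(\<forall>p. l $ p \<le> u $ p) \<and> l $ i < u $ i \<and> l $ j < u $ j \<and> l $ k < u $ k"
  then show "\<exists>b0. \<forall>b. (\<forall>r\<in>{1..m}. b0 r \<le> b r) \<longrightarrow>
      feasible (qcqp m Q c b l u) \<noteq> {} \<and>
      cuts (T7 l u i j k) (relaxation m Q c b l u S) \<and>
      cuts (T8 l u i j k) (relaxation m Q c b l u S)"
    using T7_T8_cut[OF ij jk] by blast
next
  fix b
  assume "feasible (qcqp m Q c b l u) \<noteq> {}"
  then show "redundant (T9 l u i j k) (relaxation m Q c b l u S) \<and>
      redundant (T10 l u i j k) (relaxation m Q c b l u S) \<and>
      redundant (T11 l u i j k) (relaxation m Q c b l u S) \<and>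
      redundant (T12 l u i j k) (relaxation m Q c b l u S)"
    using T9_T10_T11_T12_redundant[OF ij jk l_nonneg] feasible_qcqp_imp_bounds_le by blast
qed

end
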